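(* Let $\mathcal{A}$ be a set of infinite, strongly connected graphs, let $\mathcal{A}^r$ be the set of $\mathcal{A}$-rooted graphs $$\mathcal{A}^r=\{(G,u): G\in\mathcal{A},\ u\in G\},$$ and assume that $\mathcal{A}$ is such that $\mathcal{A}^r$ is compact. Let $P$ be a local property such that for each $G\in\mathcal{A}$ there exists a vertex $w\in G$ such that $(G,w)\in P$. Then for each $G\in\mathcal{A}$ there exist an $r_0$ and infinitely many distinct vertices $\{w_n\}_{n=1}^\infty$ such that $(G,w_n)\in P^{(r_0)}$ for all $n$.
   Context: Graphs are simple (no loops or parallel edges), possibly directed, with finitely or countably infinitely many vertices. A rooted graph $(G,u)$ is a graph $G$ with a distinguished vertex $u$, its root. A rooted graph isomorphism from $(G,u)$ to $(G',u')$ is a graph isomorphism $h$ from $G$ to $G'$ with $h(u)=u'$; write $(G,u)\cong(G',u')$ if one exists. The distance $d(u,w)$ is the length of a shortest (directed) path from $u$ to $w$. $B_r(G,u)$ is the rooted graph with root $u$ whose vertices are the vertices $w$ of $G$ with $d(u,w)\le r$ and whose edges are all edges of $G$ between these vertices. Strongly connected rooted graphs (up to rooted isomorphism) are given the metric $D((G,u),(G',u'))=2^{-R}$, where $R=\sup\{r:B_r(G,u)\cong B_r(G',u')\}$. Compactness of $\mathcal{A}^r$ is with respect to the topology induced by $D$, whose basis is the set of balls of the metric; the ball of radius $2^{-R}$ around $(G,u)$ is the set of $(G',u')$ with $B_R(G,u)\cong B_R(G',u')$. A property $P$ of rooted graphs is a local property if, for every $(G,u)\in P$, there exists an $r>0$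 such that if $B_r(G,u)\cong B_r(G',u')$ then $(G',u')\in P$. If $(G,u)\in P$ and $r$ is such that $B_r(G,u)\cong B_r(G',u')\Rightarrow(G',u')\in P$, one says that $(G,u)$ has property $P$ with radius $r$, and writes $(G,u)\in P^{(r)}$.
   Formalization: Every graph in A is additionally assumed to have finite out-degrees; without this the claim fails, e.g. for A consisting of the countably infinite undirected star and P the property that the ball of radius 1 is an infinite star rooted at its centre. *)

theory Defs
  imports "HOL-Analysis.Analysis" "Graph_Theory.Graph_Theory"
begin

definition simple_countable_digraph :: "('a, 'b) pre_digraph \<Rightarrow> bool" where
  "simple_countable_digraph G \<longleftrightarrow>
     loopfree_digraph G \<and> nomulti_digraph G \<and> countable (verts G)"

type_synonym ('a, 'b) rooted_digraph = "('a, 'b) pre_digraph \<times> 'a"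

definition rooted_graphs :: "('a, 'b) rooted_digraph set" where
  "rooted_graphs = {(G, u). simple_countable_digraph G \<and> u \<in> verts G}"

definition sc_rooted_graphs :: "('a, 'b) rooted_digraph set" where
  "sc_rooted_graphs = {(G, u) \<in> rooted_graphs. strongly_connected G}"

definition rooted_iso :: "('a, 'b) rooted_digraph \<Rightarrow> ('a, 'b) rooted_digraph \<Rightarrow> bool"
    (infix \<open>\<cong>\<^sub>r\<close> 50) where
  "x \<cong>\<^sub>r y \<longleftrightarrow>
     (\<exists>h. pre_digraph.digraph_isomorphism (fst x) h \<and>
          fst y = app_iso h (fst x) \<and> snd y = iso_verts h (snd x))"

text \<open>With unit arc weights the library's shortest-path cost is the length of a
  shortest directed path (and \<open>\<infinity>\<close> if there is none).\<close>

definition graph_dist :: "('a, 'b) pre_digraph \<Rightarrow> 'a \<Rightarrow> 'a \<Rightarrow> ereal" where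
  "graph_dist G u w = wf_digraph.\<mu> G (\<lambda>_. 1) u w"

definition rooted_ball :: "nat \<Rightarrow> ('a, 'b) rooted_digraph \<Rightarrow> ('a, 'b) rooted_digraph" where
  "rooted_ball r x =
     (fst x \<restriction> {w \<in> verts (fst x). graph_dist (fst x) (snd x) w \<le> ereal (real r)}, snd x)"

definition agreement_radius :: "('a, 'b) rooted_digraph \<Rightarrow> ('a, 'b) rooted_digraph \<Rightarrow> enat" where
  "agreement_radius x y = (SUP r \<in> {r. rooted_ball r x \<cong>\<^sub>r rooted_ball r y}. enat r)"

definition rooted_dist :: "('a, 'b) rooted_digraph \<Rightarrow> ('a, 'b) rooted_digraph \<Rightarrow> real" where
  "rooted_dist x y = (case agreement_radius x y of enat R \<Rightarrow> 1 / 2 ^ R | \<infinity> \<Rightarrow> 0)"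

text \<open>The topology is placed on rooted graphs themselves rather than on their isomorphism
  classes. As \<^const>\<open>rooted_dist\<close> depends only on the isomorphism classes of its arguments,
  every open set is a union of classes, so a set of rooted graphs is compact here iff the
  set of its isomorphism classes is compact.\<close>

definition rooted_topology :: "('a, 'b) rooted_digraph topology" where
  "rooted_topology = topology_generated_by
     {{y \<in> sc_rooted_graphs. rooted_dist x y < e} | x e. x \<in> sc_rooted_graphs \<and> e > 0}"

definition rootings :: "('a, 'b) pre_digraph set \<Rightarrow> ('a, 'b) rooted_digraph set" where
  "rootings \<A> = {(G, u). G \<in> \<A> \<and> u \<in> verts G}"

text \<open>Membership in \<open>with_radius P r\<close> is membership in \<open>P\<^sup>(\<^sup>r\<^sup>)\<close>.\<close>

definition with_radius :: "('a, 'b) rooted_digraph set \<Rightarrow> nat \<Rightarrow> ('a, 'b) rooted_digraph set" where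
  "with_radius P r =
     {x \<in> P. \<forall>y \<in> rooted_graphs. rooted_ball r x \<cong>\<^sub>r rooted_ball r y \<longrightarrow> y \<in> P}"

definition local_property :: "('a, 'b) rooted_digraph set \<Rightarrow> bool" where
  "local_property P \<longleftrightarrow>
     P \<subseteq> rooted_graphs \<and> (\<forall>x \<in> P. \<exists>r > 0. x \<in> with_radius P r)"

text \<open>Only out-degrees are required to be finite, which is what makes the (directed) balls
  finite. Without this, \<^const>\<open>rooted_dist\<close> is merely a pseudometric on isomorphism classes:
  two rooted graphs with infinite balls can agree to every radius without being isomorphic.\<close>

definition locally_finite_digraph :: "('a, 'b) pre_digraph \<Rightarrow> bool" where
  "locally_finite_digraph G \<longleftrightarrow> (\<forall>v \<in> verts G. finite (out_arcs G v))"

end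

theory Submission
  imports Defs
begin

text \<open>The point is to control distances towards the root, since in-degrees may be infinite. Let
  \<open>(H, w) \<in> P\<^sup>(\<^sup>r\<^sup>)\<close>, and let \<open>d\<close> and \<open>k\<close> be the distances from \<open>u\<close> to \<open>w\<close> and from \<open>w\<close> back to
  \<open>u\<close>. Every \<open>(G, v)\<close> whose ball of radius \<open>d + max r k\<close> is isomorphic to that of \<open>(H, u)\<close> contains
  a copy of \<open>w\<close>, which has the property with radius \<open>r\<close> and from which \<open>v\<close> is reached in \<open>k\<close> steps.
  By compactness \<open>r\<close> and \<open>k\<close> can be chosen uniformly, say equal to \<open>N\<close>. So every \<open>G \<in> \<A>\<close> is
  covered by the out-balls of radius \<open>N\<close> around the vertices having the property with radius \<open>N\<close>.
  As these balls are finite and \<open>G\<close> is not, there are infinitely many such vertices.\<close>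

section \<open>Directed balls in terms of walks\<close>

text \<open>Bounding the length of some walk, rather than the infimum in \<open>graph_dist\<close>,
  makes concatenation and transport along isomorphisms direct. The set is empty if \<open>u\<close>
  is not a vertex.\<close>

definition out_ball :: "('a, 'b) pre_digraph \<Rightarrow> 'a \<Rightarrow> nat \<Rightarrow> 'a set" where
  "out_ball G u n = {v. \<exists>p. pre_digraph.awalk G u p v \<and> length p \<le> n}"

lemma out_ballI: "pre_digraph.awalk G u p v \<Longrightarrow> length p \<le> n \<Longrightarrow> v \<in> out_ball G u n"
  by (auto simp: out_ball_def)

lemma out_ballE:
  assumes "v \<in> out_ball G u n"
  obtains p where "pre_digraph.awalk G u p v" "length p \<le> n"
  using assms by (auto simp: out_ball_def)

lemma out_ball_mono: "m \<le> n \<Longrightarrow> out_ball G u m \<subseteq> out_ball G u n"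
  by (force simp: out_ball_def)

context wf_digraph
begin

lemma out_ball_subset_verts: "out_ball G u n \<subseteq> verts G"
  by (auto elim!: out_ballE dest: awalk_last_in_verts)

lemma center_in_out_ball: "u \<in> verts G \<Longrightarrow> u \<in> out_ball G u n"
  by (rule out_ballI[of _ _ "[]"]) (simp_all add: awalk_Nil_iff)

lemma out_ball_trans:
  assumes "v \<in> out_ball G u m" "w \<in> out_ball G v n"
  shows "w \<in> out_ball G u (m + n)"
proof -
  from assms obtain p q where "awalk u p v" "length p \<le> m" "awalk v q w" "length q \<le> n"
    by (elim out_ballE) blast
  then show ?thesis
    by (intro out_ballI[of _ _ "p @ q"]) (auto intro: awalk_appendI)
qed

lemma reachable_imp_in_out_ball:
  assumes "u \<rightarrow>\<^sup>* v"
  shows "\<exists>n. v \<in> out_ball G u n"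
proof -
  from assms obtain p where "awalk u p v"
    unfolding reachable_awalk ..
  then have "v \<in> out_ball G u (length p)"
    by (rule out_ballI) simp
  then show ?thesis ..
qed

text \<open>A nonempty walk from \<open>u\<close> starts with one of finitely many arcs and
  continues as a shorter walk from its head, so the induction has to vary the centre.\<close>

lemma finite_out_ball:
  assumes "locally_finite_digraph G"
  shows "finite (out_ball G u n)"
proof (induction n arbitrary: u)
  case 0
  have "out_ball G u 0 \<subseteq> {u}"
    by (auto elim!: out_ballE simp: awalk_Nil_iff)
  then show ?case
    by (rule finite_subset) simp
next
  case (Suc n)
  show ?case
  proof (cases "u \<in> verts G")
    case True
    have "out_ball G u (Suc n) \<subseteq> insert u (\<Union>a \<in> out_arcs G u. out_ball G (head G a) n)"
    proof
      fix v
      assume "v \<in> out_ball G u (Suc n)"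
      then obtain p where p: "awalk u p v" "length p \<le> Suc n"
        by (rule out_ballE)
      then show "v \<in> insert u (\<Union>a \<in> out_arcs G u. out_ball G (head G a) n)"
        by (cases p) (auto simp: awalk_Nil_iff awalk_Cons_iff intro!: out_ballI)
    qed
    moreover have "finite (out_arcs G u)"
      using assms True by (simp add: locally_finite_digraph_def)
    ultimately show ?thesis
      using Suc.IH by (auto elim: finite_subset)
  next
    \<comment> \<open>Local finiteness says nothing about a non-vertex, but no walk starts
      there.\<close>
    case False
    then have "out_ball G u (Suc n) = {}"
      by (auto elim!: out_ballE dest: awalk_hd_in_verts)
    then show ?thesis
      by simp
  qed
qed

lemma graph_dist_le_iff: "graph_dist G u v \<le> ereal (real n) \<longleftrightarrow> v \<in> out_ball G u n"
proof -
  have cost: "awalk_cost (\<lambda>_. 1) p = real (length p)" for p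
    by (induction p) simp_all
  show ?thesis
  proof
    assume "graph_dist G u v \<le> ereal (real n)"
    \<comment> \<open>A strict bound on an infimum yields a walk below that bound; as lengths are
      integers, length below \<open>n + 1\<close> means at most \<open>n\<close>.\<close>
    also have "\<dots> < ereal (real n + 1)"
      by simp
    finally obtain p where "awalk u p v" "real (length p) < real n + 1"
      by (auto simp: graph_dist_def \<mu>_def cost INF_less_iff)
    then show "v \<in> out_ball G u n"
      by (intro out_ballI[of _ _ p]) simp_all
  next
    assume "v \<in> out_ball G u n"
    then obtain p where "awalk u p v" "length p \<le> n"
      by (rule out_ballE)
    then show "graph_dist G u v \<le> ereal (real n)"
      using min_cost_le_walk_cost[of u p v "\<lambda>_. 1"]
      by (auto simp: graph_dist_def cost elim: order_trans)
  qed
qed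

lemma rooted_ball_eq: "rooted_ball n (G, u) = (G \<restriction> out_ball G u n, u)"
proof -
  have "{w \<in> verts G. w \<in> out_ball G u n} = out_ball G u n"
    using out_ball_subset_verts by blast
  then show ?thesis
    by (simp add: rooted_ball_def graph_dist_le_iff)
qed

section \<open>Balls inside an induced ball\<close>

text \<open>Every vertex on the walk is within \<open>m + length p\<close> of \<open>u\<close>, so
  the walk never leaves the ball.\<close>

lemma awalk_induce_out_ball:
  assumes "v \<in> out_ball G u m" "awalk v p w" "m + length p \<le> n"
  shows "pre_digraph.awalk (G \<restriction> out_ball G u n) v p w"
  using assms
proof (induction p arbitrary: v m)
  case Nil
  then show ?case
    using out_ball_mono[of m n G u]
    by (auto simp: awalk_Nil_iff wf_digraph.awalk_Nil_iff[OF wellformed_induce_subgraph])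
next
  case (Cons a p)
  from Cons.prems have a: "a \<in> arcs G" "tail G a = v" and p: "awalk (head G a) p w"
    by (auto simp: awalk_Cons_iff)
  have "head G a \<in> out_ball G v 1"
    using a by (intro out_ballI[of _ _ "[a]"]) (auto simp: awalk_Cons_iff awalk_Nil_iff)
  \<comment> \<open>Depth grows by one while the remaining walk shrinks by one, so the bound
    \<open>n\<close> is preserved.\<close>
  with Cons.prems have head: "head G a \<in> out_ball G u (m + 1)"
    by (blast intro: out_ball_trans)
  with p Cons have "pre_digraph.awalk (G \<restriction> out_ball G u n) (head G a) p w"
    by simp
  moreover have "out_ball G u m \<subseteq> out_ball G u n" "out_ball G u (m + 1) \<subseteq> out_ball G u n"
    using Cons.prems by (auto intro!: out_ball_mono)
  ultimately show ?case
    using a head Cons.prems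
    by (auto simp: wf_digraph.awalk_Cons_iff[OF wellformed_induce_subgraph])
qed

lemma out_ball_induce_subset:
  assumes "S \<subseteq> verts G"
  shows "out_ball (G \<restriction> S) v n \<subseteq> out_ball G v n"
proof -
  have "awalk v p w" if "pre_digraph.awalk (G \<restriction> S) v p w" for p w
    using that assms
    by (induction p arbitrary: v)
      (auto simp: awalk_Nil_iff awalk_Cons_iff
         wf_digraph.awalk_Nil_iff[OF wellformed_induce_subgraph]
         wf_digraph.awalk_Cons_iff[OF wellformed_induce_subgraph])
  then show ?thesis
    by (auto elim!: out_ballE intro: out_ballI)
qed

text \<open>Passing to an induced subgraph creates no walks, and walks of length at most
  \<open>r\<close> from \<open>v\<close> survive because they stay within depth \<open>m + r\<close>
  of \<open>u\<close>.\<close>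

lemma out_ball_induce_out_ball:
  assumes "v \<in> out_ball G u m" "m + r \<le> n"
  shows "out_ball (G \<restriction> out_ball G u n) v r = out_ball G v r"
proof
  show "out_ball G v r \<subseteq> out_ball (G \<restriction> out_ball G u n) v r"
  proof
    fix w
    assume "w \<in> out_ball G v r"
    then obtain p where p: "awalk v p w" "length p \<le> r"
      by (rule out_ballE)
    then have "pre_digraph.awalk (G \<restriction> out_ball G u n) v p w"
      using assms by (intro awalk_induce_out_ball[of v u m]) auto
    with p show "w \<in> out_ball (G \<restriction> out_ball G u n) v r"
      by (auto intro: out_ballI)
  qed
qed (intro out_ball_induce_subset out_ball_subset_verts)

text \<open>This lets the ball around another vertex \<open>v\<close> be read off from the ball
  around \<open>u\<close> alone.\<close>

lemma rooted_ball_rooted_ball: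
  assumes "v \<in> out_ball G u m" "m + r \<le> n"
  shows "rooted_ball r (G \<restriction> out_ball G u n, v) = rooted_ball r (G, v)"
proof -
  have "out_ball G v r \<subseteq> out_ball G u n"
    using out_ball_trans[OF assms(1)] by (intro subsetI subsetD[OF out_ball_mono[OF assms(2)]])
  then have "(G \<restriction> out_ball G u n) \<restriction> out_ball G v r = G \<restriction> out_ball G v r"
    by (auto simp: induce_subgraph_def)
  then show ?thesis
    by (simp add: rooted_ball_eq wf_digraph.rooted_ball_eq[OF wellformed_induce_subgraph]
        out_ball_induce_out_ball[OF assms])
qed

section \<open>Transport of balls along isomorphisms\<close>

text \<open>Walks are mapped forward by \<open>hom\<close> and pulled back by its inverse, with the
  same length.\<close>

lemma out_ball_app_iso:
  assumes hom: "digraph_isomorphism hom" and "u \<in> verts G"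
  shows "out_ball (app_iso hom G) (iso_verts hom u) n = iso_verts hom ` out_ball G u n"
proof (intro equalityI subsetI)
  interpret H: wf_digraph "app_iso hom G"
    using hom ..
  fix v
  assume "v \<in> out_ball (app_iso hom G) (iso_verts hom u) n"
  then obtain p where p: "H.awalk (iso_verts hom u) p v" "length p \<le> n"
    by (rule out_ballE)
  then have "awalk u (map (iso_arcs (inv_iso hom)) p) (iso_verts (inv_iso hom) v)"
    using awalk_app_isoD[OF p(1) hom] assms by simp
  moreover have "v = iso_verts hom (iso_verts (inv_iso hom) v)"
    using H.awalk_last_in_verts[OF p(1)] hom by (simp add: iso_verts_iso_inv)
  ultimately show "v \<in> iso_verts hom ` out_ball G u n"
    using p by (metis imageI length_map out_ballI)
next
  fix v
  assume "v \<in> iso_verts hom ` out_ball G u n"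
  then show "v \<in> out_ball (app_iso hom G) (iso_verts hom u) n"
    by (auto elim!: out_ballE intro: awalk_app_isoI[OF _ hom] out_ballI)
qed

lemma rooted_ball_app_iso:
  assumes hom: "digraph_isomorphism hom" and u: "u \<in> verts G"
  shows "rooted_ball n (G, u) \<cong>\<^sub>r rooted_ball n (app_iso hom G, iso_verts hom u)"
proof -
  interpret H: wf_digraph "app_iso hom G"
    using hom ..
  have "app_iso hom (G \<restriction> S) = app_iso hom G \<restriction> (iso_verts hom ` S)" if S: "S \<subseteq> verts G" for S
  proof (rule pre_digraph.equality)
    \<comment> \<open>Since \<open>hom\<close> is injective on vertices, an endpoint whose image
      lies in the image of \<open>S\<close> lies in \<open>S\<close> itself; hence no extra arcs
      appear on the right.\<close>
    have "tail G a \<in> S" if "a \<in> arcs G" "iso_tail hom (iso_arcs hom a) \<in> iso_verts hom ` S" for a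
      using that S hom by (force simp: iso_verts_tail subset_iff)
    moreover have "head G a \<in> S"
      if "a \<in> arcs G" "iso_head hom (iso_arcs hom a) \<in> iso_verts hom ` S" for a
      using that S hom by (force simp: iso_verts_head subset_iff)
    ultimately show "arcs (app_iso hom (G \<restriction> S)) = arcs (app_iso hom G \<restriction> (iso_verts hom ` S))"
      using hom by (auto simp: iso_verts_tail iso_verts_head)
  qed simp_all
  moreover have "pre_digraph.digraph_isomorphism (G \<restriction> out_ball G u n) hom"
    using hom by (rule digraph_isomorphism_subgraphI)
      (intro induced_imp_subgraph induced_induce out_ball_subset_verts)
  ultimately show ?thesis
    using out_ball_subset_verts[of u n]
    by (auto simp: rooted_iso_def rooted_ball_eq H.rooted_ball_eq out_ball_app_iso[OF hom u])
qed

end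

section \<open>Rooted isomorphisms and agreement of balls\<close>

lemma rooted_iso_refl:
  assumes "wf_digraph (fst x)"
  shows "x \<cong>\<^sub>r x"
proof -
  \<comment> \<open>\<open>app_iso\<close> takes the endpoint maps of its result from the record, so
    the identity must carry those of the graph.\<close>
  let ?id = "\<lparr>iso_verts = id, iso_arcs = id, iso_head = head (fst x), iso_tail = tail (fst x)\<rparr>"
  have "pre_digraph.digraph_isomorphism (fst x) ?id" "app_iso ?id (fst x) = fst x"
    using assms by (auto simp: pre_digraph.digraph_isomorphism_def app_iso_def)
  then show ?thesis
    unfolding rooted_iso_def by (intro exI[of _ ?id]) simp
qed

lemma rooted_iso_trans:
  assumes "x \<cong>\<^sub>r y" "y \<cong>\<^sub>r z"
  shows "x \<cong>\<^sub>r z"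
proof -
  from assms obtain h k where
    h: "pre_digraph.digraph_isomorphism (fst x) h" "fst y = app_iso h (fst x)"
      "snd y = iso_verts h (snd x)" and
    k: "pre_digraph.digraph_isomorphism (fst y) k" "fst z = app_iso k (fst y)"
      "snd z = iso_verts k (snd y)"
    by (auto simp: rooted_iso_def)
  \<comment> \<open>The endpoint maps act on arcs of the final graph, so they come from
    \<open>k\<close> alone.\<close>
  let ?kh = "\<lparr>iso_verts = iso_verts k \<circ> iso_verts h, iso_arcs = iso_arcs k \<circ> iso_arcs h,
    iso_head = iso_head k, iso_tail = iso_tail k\<rparr>"
  have "pre_digraph.digraph_isomorphism (fst x) ?kh"
    using h k by (auto simp: pre_digraph.digraph_isomorphism_def intro!: comp_inj_on)
  moreover have "fst z = app_iso ?kh (fst x)" "snd z = iso_verts ?kh (snd x)"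
    using h k by (auto simp: app_iso_def image_comp)
  ultimately show ?thesis
    unfolding rooted_iso_def by blast
qed

text \<open>An isomorphism of the balls at the roots restricts to the ball of radius
  \<open>r\<close> around any vertex at depth \<open>m\<close>, provided that ball lies within
  radius \<open>n\<close>. One map \<open>f\<close> serves all \<open>w\<close>, \<open>m\<close>
  and \<open>r\<close>: the isomorphisms carry properties with a radius, the equality of images
  carries walks from \<open>w\<close> back to the root.\<close>

lemma rooted_ball_iso_transfer:
  assumes G: "wf_digraph G" and H: "wf_digraph H"
    and iso: "rooted_ball n (G, u) \<cong>\<^sub>r rooted_ball n (H, v)"
  obtains f where "f u = v"
    and "\<And>w m r. w \<in> out_ball G u m \<Longrightarrow> m + r \<le> n \<Longrightarrow>
      rooted_ball r (G, w) \<cong>\<^sub>r rooted_ball r (H, f w)"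
    and "\<And>w m r. w \<in> out_ball G u m \<Longrightarrow> m + r \<le> n \<Longrightarrow>
      f ` out_ball G w r = out_ball H (f w) r"
proof -
  interpret G: wf_digraph G by fact
  interpret H: wf_digraph H by fact
  let ?G = "G \<restriction> out_ball G u n" and ?H = "H \<restriction> out_ball H v n"
  interpret G': wf_digraph ?G by (rule G.wellformed_induce_subgraph)
  obtain h where h: "G'.digraph_isomorphism h" "?H = app_iso h ?G" "v = iso_verts h u"
    using iso by (auto simp: rooted_iso_def G.rooted_ball_eq H.rooted_ball_eq)
  have ball: "rooted_ball r (G, w) \<cong>\<^sub>r rooted_ball r (H, iso_verts h w)"
    and out: "iso_verts h ` out_ball G w r = out_ball H (iso_verts h w) r"
    if w: "w \<in> out_ball G u m" and mr: "m + r \<le> n" for w m r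
  proof -
    have u: "u \<in> verts G"
      using w by (auto elim!: out_ballE dest: G.awalk_hd_in_verts)
    have w': "w \<in> verts ?G"
      using w mr out_ball_mono[of m n G u] by auto
    have "out_ball ?G u m = out_ball G u m"
      using mr G.center_in_out_ball[OF u, of 0] by (intro G.out_ball_induce_out_ball[of u u 0]) auto
    then have "iso_verts h w \<in> out_ball (app_iso h ?G) (iso_verts h u) m"
      using w u h(1) by (subst G'.out_ball_app_iso) (simp_all add: G.center_in_out_ball)
    then have "iso_verts h w \<in> out_ball ?H v m"
      by (simp only: h(2)[symmetric] h(3)[symmetric])
    \<comment> \<open>The image of \<open>w\<close> must also have depth at most \<open>m\<close> in
      \<open>H\<close> before the ball around it can be read off from \<open>?H\<close>.\<close>
    then have image: "iso_verts h w \<in> out_ball H v m"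
      using H.out_ball_induce_subset[OF H.out_ball_subset_verts] by blast
    have "rooted_ball r (?G, w) \<cong>\<^sub>r rooted_ball r (?H, iso_verts h w)"
      using G'.rooted_ball_app_iso[OF h(1) w'] by (simp only: h(2)[symmetric])
    then show "rooted_ball r (G, w) \<cong>\<^sub>r rooted_ball r (H, iso_verts h w)"
      using G.rooted_ball_rooted_ball[OF w mr] H.rooted_ball_rooted_ball[OF image mr] by simp
    have "iso_verts h ` out_ball ?G w r = out_ball ?H (iso_verts h w) r"
      using G'.out_ball_app_iso[OF h(1) w'] by (simp only: h(2)[symmetric])
    then show "iso_verts h ` out_ball G w r = out_ball H (iso_verts h w) r"
      using G.out_ball_induce_out_ball[OF w mr] H.out_ball_induce_out_ball[OF image mr] by simp
  qed
  show thesis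
    using that[of "iso_verts h"] h(3) ball out by blast
qed

text \<open>The case of the transfer where the inner ball is centred at the root, at depth
  0.\<close>

lemma rooted_ball_iso_antimono:
  assumes "wf_digraph (fst x)" "wf_digraph (fst y)" "snd x \<in> verts (fst x)"
    and "rooted_ball n x \<cong>\<^sub>r rooted_ball n y" "m \<le> n"
  shows "rooted_ball m x \<cong>\<^sub>r rooted_ball m y"
proof -
  have "rooted_ball n (fst x, snd x) \<cong>\<^sub>r rooted_ball n (fst y, snd y)"
    using assms(4) by simp
  then show ?thesis
  proof (rule rooted_ball_iso_transfer[OF assms(1,2)])
    fix f
    assume "f (snd x) = snd y"
      and "\<And>w d r. w \<in> out_ball (fst x) (snd x) d \<Longrightarrow> d + r \<le> n \<Longrightarrow>
        rooted_ball r (fst x, w) \<cong>\<^sub>r rooted_ball r (fst y, f w)"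
    from this(1) this(2)[of "snd x" 0 m] show ?thesis
      using assms(3,5) wf_digraph.center_in_out_ball[OF assms(1,3)] by simp
  qed
qed

section \<open>Properties with a radius\<close>

lemma rooted_graphs_iff:
  "(G, u) \<in> rooted_graphs \<longleftrightarrow> simple_countable_digraph G \<and> u \<in> verts G"
  by (simp add: rooted_graphs_def)

lemma simple_countable_imp_wf: "simple_countable_digraph G \<Longrightarrow> wf_digraph G"
  by (simp add: simple_countable_digraph_def loopfree_digraph_def)

lemma rooted_graphs_imp_wf: "x \<in> rooted_graphs \<Longrightarrow> wf_digraph (fst x)"
  by (auto simp: rooted_graphs_def simple_countable_imp_wf)

lemma rooted_graphs_root: "x \<in> rooted_graphs \<Longrightarrow> snd x \<in> verts (fst x)"
  by (auto simp: rooted_graphs_def)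


text \<open>Agreement on the larger ball implies agreement on the smaller one. The intersection
  supplies the well-formedness and the root that this implication uses.\<close>

lemma with_radius_mono:
  assumes "m \<le> n"
  shows "with_radius P m \<inter> rooted_graphs \<subseteq> with_radius P n"
proof
  fix x
  assume x: "x \<in> with_radius P m \<inter> rooted_graphs"
  then have "rooted_ball m x \<cong>\<^sub>r rooted_ball m y"
    if "y \<in> rooted_graphs" "rooted_ball n x \<cong>\<^sub>r rooted_ball n y" for y
    using rooted_ball_iso_antimono[OF _ _ _ that(2) assms] that(1)
    by (simp add: rooted_graphs_imp_wf rooted_graphs_root)
  with x show "x \<in> with_radius P n"
    by (simp add: with_radius_def)
qed

text \<open>By transitivity, whatever agrees with \<open>y\<close> to radius \<open>r\<close>
  already agrees with \<open>x\<close>, so the radius is inherited without loss.\<close>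

lemma with_radius_iso:
  assumes "x \<in> with_radius P r" "y \<in> rooted_graphs"
    and "rooted_ball r x \<cong>\<^sub>r rooted_ball r y"
  shows "y \<in> with_radius P r"
  using assms rooted_iso_trans[OF assms(3)] by (simp add: with_radius_def)

section \<open>From compactness to a uniform constant\<close>

lemma rooted_dist_self:
  assumes "x \<in> rooted_graphs"
  shows "rooted_dist x x = 0"
proof -
  interpret wf_digraph "fst x" using assms by (rule rooted_graphs_imp_wf)
  have "rooted_ball r x \<cong>\<^sub>r rooted_ball r x" for r
    using rooted_ball_eq[of r "snd x"] by (intro rooted_iso_refl) auto
  then have "agreement_radius x x = (SUP r. enat r)"
    by (simp add: agreement_radius_def)
  also have "\<dots> = \<infinity>"
    unfolding top_enat_def[symmetric] by (rule SUP_eq_top_iff[THEN iffD2])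
      (metis UNIV_I enat_ord_simps(2) lessI top_enat_def less_infinityE)
  finally show ?thesis
    by (simp add: rooted_dist_def)
qed

text \<open>The strict inequality puts the supremum above \<open>n\<close>, hence some agreeing
  radius exceeds \<open>n\<close>; agreement passes down to smaller radii.\<close>

lemma rooted_dist_less_imp_iso:
  assumes "x \<in> rooted_graphs" "y \<in> rooted_graphs" "rooted_dist x y < 1 / 2 ^ n"
  shows "rooted_ball n x \<cong>\<^sub>r rooted_ball n y"
proof -
  have "enat n < agreement_radius x y"
  proof (cases "agreement_radius x y")
    case (enat R)
    with assms have "(2::real) ^ n < 2 ^ R"
      by (simp add: rooted_dist_def field_simps)
    with enat show ?thesis
      by simp
  qed simp
  then obtain r where "n < r" "rooted_ball r x \<cong>\<^sub>r rooted_ball r y"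
    by (auto simp: agreement_radius_def less_SUP_iff)
  then show ?thesis
    using assms by (auto intro: rooted_ball_iso_antimono rooted_graphs_imp_wf rooted_graphs_root)
qed

text \<open>Around each \<open>x\<close> one index works on a whole open metric ball. Finitely many
  such balls cover \<open>K\<close>, and by monotonicity the largest of their indices works
  everywhere.\<close>

lemma compactin_rooted_uniform:
  fixes Q :: "nat \<Rightarrow> ('a, 'b) rooted_digraph \<Rightarrow> bool"
  assumes compact: "compactin rooted_topology K" and K: "K \<subseteq> sc_rooted_graphs"
    and mono: "\<And>m n x. x \<in> K \<Longrightarrow> m \<le> n \<Longrightarrow> Q m x \<Longrightarrow> Q n x"
    and local: "\<And>x. x \<in> K \<Longrightarrow>
      \<exists>R n. \<forall>y \<in> K. rooted_ball R x \<cong>\<^sub>r rooted_ball R y \<longrightarrow> Q n y"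
  shows "\<exists>N. \<forall>x \<in> K. Q N x"
proof -
  obtain R n where Rn: "\<And>x y. x \<in> K \<Longrightarrow> y \<in> K \<Longrightarrow>
      rooted_ball (R x) x \<cong>\<^sub>r rooted_ball (R x) y \<Longrightarrow> Q (n x) y"
    using local by metis
  \<comment> \<open>This metric radius forces agreement of balls to radius
    \<open>R x\<close>.\<close>
  define U where "U x = {y \<in> sc_rooted_graphs. rooted_dist x y < 1 / 2 ^ R x}" for x
  have rooted: "x \<in> rooted_graphs" if "x \<in> sc_rooted_graphs" for x
    using that by (auto simp: sc_rooted_graphs_def)
  have "openin rooted_topology (U x)" if "x \<in> K" for x
    unfolding rooted_topology_def U_def using that K
    by (intro topology_generated_by_Basis CollectI exI[of _ x] exI[of _ "1 / 2 ^ R x"]) auto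
  then have "openin rooted_topology V" if "V \<in> U ` K" for V
    using that by blast
  moreover have "K \<subseteq> \<Union> (U ` K)"
  proof
    fix x
    assume "x \<in> K"
    moreover from this K have "x \<in> sc_rooted_graphs"
      by blast
    then have "x \<in> U x"
      by (simp add: U_def rooted_dist_self rooted)
    ultimately show "x \<in> \<Union> (U ` K)"
      by blast
  qed
  ultimately obtain \<F> where \<F>: "finite \<F>" "\<F> \<subseteq> U ` K" "K \<subseteq> \<Union> \<F>"
    using compactinD[OF compact, of "U ` K"] by metis
  from finite_subset_image[OF \<F>(1,2)] obtain F
    where F: "finite F" "F \<subseteq> K" "K \<subseteq> \<Union> (U ` F)"
    using \<F>(3) by blast
  have "Q (Max (n ` F)) y" if y: "y \<in> K" for y
  proof -
    obtain x where x: "x \<in> F" "y \<in> U x"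
      using F y by auto
    then have "x \<in> sc_rooted_graphs" "y \<in> sc_rooted_graphs" "rooted_dist x y < 1 / 2 ^ R x"
      using F(2) K by (auto simp: U_def)
    then have "rooted_ball (R x) x \<cong>\<^sub>r rooted_ball (R x) y"
      by (intro rooted_dist_less_imp_iso rooted)
    then have "Q (n x) y"
      using F(2) x(1) y by (intro Rn) auto
    \<comment> \<open>The maximum is meaningful here, as \<open>x\<close> witnesses that
      \<open>F\<close> is nonempty.\<close>
    moreover have "n x \<le> Max (n ` F)"
      using F x by simp
    ultimately show "Q (Max (n ` F)) y"
      using mono[OF y] by blast
  qed
  then show ?thesis
    by blast
qed

section \<open>Infinitely many vertices with a common radius\<close>

theorem lemma3p13:
  fixes \<A> :: "('a, 'b) pre_digraph set"
    and P :: "('a, 'b) rooted_digraph set"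
  assumes "\<And>G. G \<in> \<A> \<Longrightarrow> simple_countable_digraph G"
    and "\<And>G. G \<in> \<A> \<Longrightarrow> locally_finite_digraph G"
    and "\<And>G. G \<in> \<A> \<Longrightarrow> infinite (verts G)"
    and "\<And>G. G \<in> \<A> \<Longrightarrow> strongly_connected G"
    and "compactin rooted_topology (rootings \<A>)"
    and "local_property P"
    and "\<And>G. G \<in> \<A> \<Longrightarrow> \<exists>w \<in> verts G. (G, w) \<in> P"
  shows "\<forall>G \<in> \<A>. \<exists>r0. \<exists>w :: nat \<Rightarrow> 'a.
           inj w \<and> (\<forall>n. w n \<in> verts G \<and> (G, w n) \<in> with_radius P r0)"
proof -
  \<comment> \<open>A single index bounds both the radius of the property at \<open>w\<close> and
    the distance from \<open>w\<close> to the root, in that direction; this makes \<open>Q\<close>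
    monotone and one \<open>N\<close> sufficient.\<close>
  define Q where "Q n x \<longleftrightarrow> (\<exists>w \<in> verts (fst x). (fst x, w) \<in> with_radius P n \<and>
    snd x \<in> out_ball (fst x) w n)" for n and x :: "('a, 'b) rooted_digraph"
  have rooted: "(G, u) \<in> rooted_graphs" if "G \<in> \<A>" "u \<in> verts G" for G u
    using that assms(1) by (simp add: rooted_graphs_iff)
  have wf: "wf_digraph G" if "G \<in> \<A>" for G
    using that assms(1) by (simp add: simple_countable_imp_wf)
  have "\<exists>N. \<forall>x \<in> rootings \<A>. Q N x"
  proof (rule compactin_rooted_uniform[OF assms(5), of Q])
    show "rootings \<A> \<subseteq> sc_rooted_graphs"
      using assms(4) rooted by (auto simp: rootings_def sc_rooted_graphs_def)
  next
    fix m n :: nat and x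
    assume x: "x \<in> rootings \<A>" and "m \<le> n" "Q m x"
    then obtain w where w: "w \<in> verts (fst x)" "(fst x, w) \<in> with_radius P m"
      "snd x \<in> out_ball (fst x) w m"
      by (auto simp: Q_def)
    have "(fst x, w) \<in> rooted_graphs"
      using x w(1) rooted by (auto simp: rootings_def)
    with w(2) have "(fst x, w) \<in> with_radius P n"
      using with_radius_mono[OF \<open>m \<le> n\<close>] by blast
    then show "Q n x"
      using w(1) subsetD[OF out_ball_mono[OF \<open>m \<le> n\<close>] w(3)] by (auto simp: Q_def)
  next
    fix x
    assume "x \<in> rootings \<A>"
    then obtain G u where x: "x = (G, u)" and G: "G \<in> \<A>" and u: "u \<in> verts G"
      by (auto simp: rootings_def)
    interpret wf_digraph G using G by (rule wf)
    obtain w where w: "w \<in> verts G" "(G, w) \<in> P"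
      using assms(7) G by blast
    then obtain r where r: "(G, w) \<in> with_radius P r"
      using assms(6) by (auto simp: local_property_def)
    have "u \<rightarrow>\<^sup>*\<^bsub>G\<^esub> w" "w \<rightarrow>\<^sup>*\<^bsub>G\<^esub> u"
      using assms(4)[OF G] u w by auto
    then obtain d k where d: "w \<in> out_ball G u d" and k: "u \<in> out_ball G w k"
      by (meson reachable_imp_in_out_ball)
    define n where "n = max r k"
    have rn: "(G, w) \<in> with_radius P n"
      using with_radius_mono[of r n P] r rooted[OF G w(1)] by (auto simp: n_def)
    have kn: "u \<in> out_ball G w n"
      using k out_ball_mono[of k n G w] by (auto simp: n_def)
    \<comment> \<open>The vertex \<open>w\<close> has depth \<open>d\<close>, so radius
      \<open>d + n\<close> is what makes its whole ball of radius \<open>n\<close> visible from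
      \<open>u\<close>.\<close>
    have "Q n y" if y: "y \<in> rootings \<A>" "rooted_ball (d + n) x \<cong>\<^sub>r rooted_ball (d + n) y" for y
    proof -
      obtain H v where H: "y = (H, v)" "H \<in> \<A>"
        using y by (auto simp: rootings_def)
      show ?thesis
      proof (rule rooted_ball_iso_transfer[OF wf[OF G] wf[OF H(2)] y(2)[unfolded x H(1)]])
        fix f
        assume f: "f u = v"
          "\<And>w m r. w \<in> out_ball G u m \<Longrightarrow> m + r \<le> d + n \<Longrightarrow>
            rooted_ball r (G, w) \<cong>\<^sub>r rooted_ball r (H, f w)"
          "\<And>w m r. w \<in> out_ball G u m \<Longrightarrow> m + r \<le> d + n \<Longrightarrow>
            f ` out_ball G w r = out_ball H (f w) r"
        \<comment> \<open>The return walk from \<open>w\<close> to \<open>u\<close> lies in that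
          ball and is carried to one from \<open>f w\<close> to \<open>f u = v\<close>.\<close>
        have v: "v \<in> out_ball H (f w) n"
          using kn f(1) f(3)[OF d order_refl] by blast
        then have fw: "f w \<in> verts H"
          using wf_digraph.awalk_hd_in_verts[OF wf[OF H(2)]] by (auto elim: out_ballE)
        have "(H, f w) \<in> with_radius P n"
          using with_radius_iso[OF rn rooted[OF H(2) fw] f(2)[OF d order_refl]] .
        with v fw H(1) show "Q n y"
          by (auto simp: Q_def)
      qed
    qed
    then show "\<exists>R n. \<forall>y \<in> rootings \<A>. rooted_ball R x \<cong>\<^sub>r rooted_ball R y \<longrightarrow> Q n y"
      by blast
  qed
  then obtain N where N: "\<And>x. x \<in> rootings \<A> \<Longrightarrow> Q N x"
    by blast
  show ?thesis
  proof
    fix G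
    assume G: "G \<in> \<A>"
    interpret wf_digraph G using G by (rule wf)
    define W where "W = {w \<in> verts G. (G, w) \<in> with_radius P N}"
    \<comment> \<open>Each vertex of \<open>G\<close> is used as a root: \<open>Q N\<close> then
      gives a member of \<open>W\<close> within \<open>N\<close> steps of it.\<close>
    have "verts G \<subseteq> (\<Union>w \<in> W. out_ball G w N)"
      using N G by (force simp: W_def Q_def rootings_def)
    then have "infinite W"
      using assms(2,3)[OF G] finite_out_ball by (meson finite_UN_I finite_subset)
    then obtain w :: "nat \<Rightarrow> 'a" where "inj w" "range w \<subseteq> W"
      unfolding infinite_iff_countable_subset by auto
    then show "\<exists>r0. \<exists>w :: nat \<Rightarrow> 'a.
        inj w \<and> (\<forall>n. w n \<in> verts G \<and> (G, w n) \<in> with_radius P r0)"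
      by (intro exI[of _ N] exI[of _ w]) (auto simp: W_def)
  qed
qed

end
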